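(* Let $G$ be a finite graph with complement $\overline{G}$. Then, as functions of the weight $p$ on the common vertex set, $$\alpha_G=\mathfrak{B}\alpha^*_{\overline{G}},\qquad \alpha^*_G=\mathfrak{B}\alpha_{\overline{G}},\qquad \vartheta_G=\mathfrak{B}\vartheta_{\overline{G}}.$$
   Context: Graphs are finite, undirected and loopless, with vertex set $V=V(G)$, $|V|=n\ge1$; $u\sim v$ means $u,v$ are adjacent. The complement $\overline{G}$ has the same vertices, and two distinct vertices are adjacent in $\overline{G}$ iff they are not adjacent in $G$. A weight on $G$ is a function $p:V\to[0,\infty)$; weights are identified with elements of $\mathbb{R}^n_+$ (vectors with nonnegative coordinates), and $\langle p,q\rangle=\sum_{v\in V}p(v)q(v)$. For a function $f:\mathbb{R}^n_+\to[0,\infty)$ with $f(q)>0$ for $q\ne0$, the transform is $(\mathfrak{B}f)(p)=\sup_{q\in\mathbb{R}^n_+,\,q\neq0}\frac{\langle p,q\rangle}{f(q)}$. Weighted independence number: $\alpha_G(p)=\max_I\sum_{v\in I}p(v)$, over independent sets $I\subset V$ (distinct vertices of $I$ are non-adjacent). Weighted fractional packing number: $\alpha^*_G(p)=\max_q\sum_{v\in V}p(v)q(v)$, over $q:V\to[0,1]$ with $\sum_{v\in C}q(v)\le1$ for all cliques $C$ of $G$ (a clique is a set of vertices any two distinct members of which are adjacent). Weighted Lovász number: an orthonormal representation of a graph $G$ with $n$ vertices is an assignment $v\mapsto\psi_v\in\mathbb{R}^n$ of unit vectors such that $\psi_u\perp\psi_v$ whenever $u\ne v$ are non-adjacent in $G$.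 Then $\vartheta_G(p)=\max_{c,\psi}\sum_{v\in V}p(v)|\langle c,\psi_v\rangle|^2$, where $c$ ranges over unit vectors of $\mathbb{R}^n$ and $\psi$ over orthonormal representations of $\overline{G}$. *)

theory Defs
  imports "HOL-Analysis.Analysis" "HOL-Library.Ramsey"
begin

text \<open>
  The vertex set is the whole of a finite type \<open>'v\<close>, and a graph is its edge set
  \<open>E \<subseteq> [UNIV]\<^bsup>2\<^esup>\<close>. Cliques and independent sets are \<^const>\<open>clique\<close> and \<^const>\<open>indep\<close>
  of \<open>HOL-Library.Ramsey\<close>.
\<close>

definition graph_compl :: "'v::finite set set \<Rightarrow> 'v set set" where
  "graph_compl E = [UNIV]\<^bsup>2\<^esup> - E"

definition weights :: "(real ^ 'v::finite) set" where
  "weights = {p. \<forall>v. 0 \<le> p $ v}"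

definition indep_number :: "'v::finite set set \<Rightarrow> real ^ 'v \<Rightarrow> real" where
  "indep_number E p = Max {\<Sum>v\<in>I. p $ v | I. indep I E}"

definition frac_packings :: "'v::finite set set \<Rightarrow> (real ^ 'v) set" where
  "frac_packings E =
     {q. (\<forall>v. 0 \<le> q $ v \<and> q $ v \<le> 1) \<and> (\<forall>C. clique C E \<longrightarrow> (\<Sum>v\<in>C. q $ v) \<le> 1)}"

text \<open>
  The two maxima over infinite sets below are written as suprema; the lemmas
  \<open>frac_packing_number_attained\<close> and \<open>lovasz_number_attained\<close> show that they are maxima.
\<close>

definition frac_packing_number :: "'v::finite set set \<Rightarrow> real ^ 'v \<Rightarrow> real" where
  "frac_packing_number E p = (SUP q\<in>frac_packings E. \<Sum>v\<in>UNIV. p $ v * q $ v)"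

definition orthonormal_rep :: "'v::finite set set \<Rightarrow> ('v \<Rightarrow> real ^ 'v) \<Rightarrow> bool" where
  "orthonormal_rep E \<psi> \<longleftrightarrow>
     (\<forall>v. norm (\<psi> v) = 1) \<and>
     (\<forall>u v. u \<noteq> v \<and> {u, v} \<notin> E \<longrightarrow> orthogonal (\<psi> u) (\<psi> v))"

definition lovasz_number :: "'v::finite set set \<Rightarrow> real ^ 'v \<Rightarrow> real" where
  "lovasz_number E p =
     (SUP (c, \<psi>) \<in> {(c, \<psi>). norm c = 1 \<and> orthonormal_rep (graph_compl E) \<psi>}.
        \<Sum>v\<in>UNIV. p $ v * \<bar>c \<bullet> \<psi> v\<bar>\<^sup>2)"

text \<open>
  The supremum is taken in the extended reals, so that an unbounded quotient gives \<open>\<infinity>\<close>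
  instead of an unspecified real. The quotient is only meaningful for \<open>f\<close> positive on nonzero
  weights, which the three graph parameters are (lemmas \<open>indep_number_pos\<close>,
  \<open>frac_packing_number_pos\<close> and \<open>lovasz_number_pos\<close>).
\<close>

definition sup_transform :: "(real ^ 'v::finite \<Rightarrow> real) \<Rightarrow> real ^ 'v \<Rightarrow> ereal" where
  "sup_transform f p = (SUP q \<in> weights - {0}. ereal ((p \<bullet> q) / f q))"

lemma indep_number_pos:
  assumes "q \<in> weights" "q \<noteq> 0"
  shows "0 < indep_number E q"
proof -
  obtain v where v: "q $ v \<noteq> 0" using assms(2) by (auto simp: vec_eq_iff)
  then have pos: "0 < q $ v" using assms(1) by (auto simp: weights_def order_less_le)
  have fin: "finite {\<Sum>v\<in>I. q $ v | I. indep I E}" by simp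
  have "indep {v} E" by (auto simp: indep_def)
  then have "q $ v \<in> {\<Sum>v\<in>I. q $ v | I. indep I E}"
    by (intro CollectI exI[of _ "{v}"]) simp
  from Max_ge[OF fin this] pos show ?thesis by (simp add: indep_number_def)
qed

lemma compact_frac_packings: "compact (frac_packings E)"
proof -
  have "frac_packings E =
      cbox 0 1 \<inter> (\<Inter>C\<in>{C. clique C E}. {q. (\<Sum>v\<in>C. q $ v) \<le> 1})"
    by (auto simp: frac_packings_def mem_box_cart)
  moreover have "closed (\<Inter>C\<in>{C. clique C E}. {q::real^'a. (\<Sum>v\<in>C. q $ v) \<le> 1})"
    by (intro closed_INT ballI closed_Collect_le continuous_intros)
  ultimately show ?thesis by (simp add: compact_Int_closed)
qed

lemma axis_in_frac_packings: "axis v 1 \<in> frac_packings E"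
proof -
  have "(\<Sum>u\<in>C. axis v (1::real) $ u) \<le> 1" for C
  proof -
    have "(\<Sum>u\<in>C. axis v (1::real) $ u) \<le> (\<Sum>u\<in>UNIV. axis v (1::real) $ u)"
      by (intro sum_mono2) (auto simp: axis_def)
    also have "\<dots> = 1" by (simp add: axis_def)
    finally show ?thesis .
  qed
  then show ?thesis by (auto simp: frac_packings_def axis_def)
qed

lemma frac_packing_number_attained:
  obtains q where "q \<in> frac_packings E"
    and "frac_packing_number E p = (\<Sum>v\<in>UNIV. p $ v * q $ v)"
    and "\<And>r. r \<in> frac_packings E \<Longrightarrow> (\<Sum>v\<in>UNIV. p $ v * r $ v) \<le> frac_packing_number E p"
proof -
  have "continuous_on (frac_packings E) (\<lambda>q. \<Sum>v\<in>UNIV. p $ v * q $ v)"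
    by (intro continuous_intros)
  from continuous_attains_sup[OF compact_frac_packings _ this]
  obtain q where q: "q \<in> frac_packings E"
    "\<forall>r\<in>frac_packings E. (\<Sum>v\<in>UNIV. p $ v * r $ v) \<le> (\<Sum>v\<in>UNIV. p $ v * q $ v)"
    using axis_in_frac_packings by blast
  then have "frac_packing_number E p = (\<Sum>v\<in>UNIV. p $ v * q $ v)"
    unfolding frac_packing_number_def by (intro cSup_eq_maximum) auto
  with q that show thesis by metis
qed

lemma frac_packing_number_pos:
  assumes "q \<in> weights" "q \<noteq> 0"
  shows "0 < frac_packing_number E q"
proof -
  obtain v where v: "q $ v \<noteq> 0" using assms(2) by (auto simp: vec_eq_iff)
  then have "0 < q $ v" using assms(1) by (auto simp: weights_def order_less_le)
  also have "q $ v = (\<Sum>u\<in>UNIV. q $ u * axis v 1 $ u)"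
    by (simp add: axis_def if_distrib cong: if_cong)
  also have "\<dots> \<le> frac_packing_number E q"
    using frac_packing_number_attained axis_in_frac_packings by metis
  finally show ?thesis .
qed

lemma orthonormal_rep_axis: "orthonormal_rep E (\<lambda>v. axis v 1)"
  by (auto simp: orthonormal_rep_def orthogonal_def inner_axis_axis)

lemma lovasz_number_attained:
  fixes p :: "real ^ 'v::finite"
  obtains c \<psi> where "norm c = 1" and "orthonormal_rep (graph_compl E) \<psi>"
    and "lovasz_number E p = (\<Sum>v\<in>UNIV. p $ v * \<bar>c \<bullet> \<psi> v\<bar>\<^sup>2)"
    and "\<And>d \<phi>. norm d = 1 \<Longrightarrow> orthonormal_rep (graph_compl E) \<phi> \<Longrightarrow>
           (\<Sum>v\<in>UNIV. p $ v * \<bar>d \<bullet> \<phi> v\<bar>\<^sup>2) \<le> lovasz_number E p"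
proof -
  define K :: "(real^'v^'v) set" where "K = {M. orthonormal_rep (graph_compl E) (($) M)}"
  define S :: "((real^'v) \<times> (real^'v^'v)) set" where "S = sphere 0 1 \<times> K"
  define g where "g = (\<lambda>(c, M::real^'v^'v). \<Sum>v\<in>UNIV. p $ v * \<bar>c \<bullet> M $ v\<bar>\<^sup>2)"
  have K_eq: "K = (\<Inter>v. {M. norm (M $ v) = 1}) \<inter>
      (\<Inter>(u, v)\<in>{(u, v). u \<noteq> v \<and> {u, v} \<notin> graph_compl E}. {M. M $ u \<bullet> M $ v = 0})"
    by (auto simp: K_def orthonormal_rep_def orthogonal_def)
  have nth_lambda: "($) (\<chi> v. \<phi> v) = \<phi>" for \<phi> :: "'v \<Rightarrow> real^'v"
    by (simp add: fun_eq_iff)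
  have "closed K"
    unfolding K_eq case_prod_unfold
    by (intro closed_Int closed_INT ballI closed_Collect_eq continuous_intros)
  moreover have "bounded K"
  proof (rule boundedI)
    fix M assume "M \<in> K"
    then have "norm (M $ v) = 1" for v by (auto simp: K_eq)
    then show "norm M \<le> sqrt CARD('v)" by (simp add: norm_vec_def L2_set_def)
  qed
  ultimately have "compact S"
    unfolding S_def by (intro compact_Times compact_sphere) (simp add: compact_eq_bounded_closed)
  moreover have "(axis undefined 1, \<chi> v. axis v 1) \<in> S"
    using orthonormal_rep_axis[of "graph_compl E"] by (simp add: S_def K_def nth_lambda)
  moreover have "continuous_on S g"
    unfolding g_def case_prod_unfold by (intro continuous_intros)
  ultimately obtain x where x: "x \<in> S" "\<forall>y\<in>S. g y \<le> g x"
    using continuous_attains_sup[of S g] by blast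
  obtain c M where cM: "x = (c, M)" by (cases x)
  have c: "norm c = 1" and M: "orthonormal_rep (graph_compl E) (($) M)"
    using x(1) by (auto simp: cM S_def K_def)
  have le: "(\<Sum>v\<in>UNIV. p $ v * \<bar>d \<bullet> \<phi> v\<bar>\<^sup>2) \<le> g x"
    if "norm d = 1" "orthonormal_rep (graph_compl E) \<phi>" for d \<phi>
  proof -
    have "(d, \<chi> v. \<phi> v) \<in> S" using that by (simp add: S_def K_def nth_lambda)
    with x(2) have "g (d, \<chi> v. \<phi> v) \<le> g x" by blast
    then show ?thesis by (simp add: g_def)
  qed
  have gx: "g x = (\<Sum>v\<in>UNIV. p $ v * \<bar>c \<bullet> M $ v\<bar>\<^sup>2)"
    by (simp add: g_def cM)
  have "lovasz_number E p = g x"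
    unfolding lovasz_number_def
  proof (rule cSup_eq_maximum)
    show "g x \<in> (\<lambda>(c, \<psi>). \<Sum>v\<in>UNIV. p $ v * \<bar>c \<bullet> \<psi> v\<bar>\<^sup>2) `
        {(c, \<psi>). norm c = 1 \<and> orthonormal_rep (graph_compl E) \<psi>}"
      unfolding gx using c M by (intro image_eqI[of _ _ "(c, ($) M)"]) auto
  qed (use le in auto)
  with that[OF c M] le gx show thesis by simp
qed

lemma lovasz_number_pos:
  assumes "q \<in> weights" "q \<noteq> 0"
  shows "0 < lovasz_number E q"
proof -
  obtain v where v: "q $ v \<noteq> 0" using assms(2) by (auto simp: vec_eq_iff)
  then have "0 < q $ v" using assms(1) by (auto simp: weights_def order_less_le)
  also have "q $ v = (\<Sum>u\<in>UNIV. q $ u * \<bar>axis v (1::real) \<bullet> axis u 1\<bar>\<^sup>2)"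
    by (simp add: inner_axis_axis if_distrib[of "\<lambda>x. x\<^sup>2"] if_distrib[of "\<lambda>x. _ * x"] if_distrib[of abs] cong: if_cong)
  also have "\<dots> \<le> lovasz_number E q"
    using lovasz_number_attained[of E q] orthonormal_rep_axis norm_axis_1 by metis
  finally show ?thesis .
qed

end

theory Submission
  imports Defs
begin

text \<open>
  Each of the three identities splits into an upper bound on the quotient
  \<open>(p \<bullet> q) / f q\<close>, valid for every weight \<open>q\<close>, and one weight \<open>r\<close> that reaches it; the
  extremal object for the left-hand side always supplies \<open>r\<close> (\<open>sup_transform_eqI\<close>).

  For \<open>\<alpha>\<close> and \<open>\<alpha>\<^sup>*\<close> both parts come from one remark: cliques of the complement are
  independent sets of \<open>G\<close>, so the fractional packings of the complement are exactly the weights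
  \<open>r\<close> with \<open>\<alpha>\<^sub>G r \<le> 1\<close>. Scaling \<open>p\<close> into that set gives
  \<open>p \<bullet> q \<le> \<alpha>\<^sub>G p * \<alpha>\<^sup>* q\<close>, with \<open>\<alpha>\<^sup>*\<close> taken in the complement. The bound is reached by the
  indicator vector of a heaviest independent set in one case, and by an optimal packing in
  the other.

  For \<open>\<theta>\<close>, let \<open>c\<close>, \<open>\<psi>\<close> be optimal for \<open>G\<close> and put \<open>r v = (c \<bullet> \<psi> v)\<^sup>2\<close>. If \<open>\<phi>\<close> is a
  representation used for the complement, then any two distinct vertices are
  orthogonal under \<open>\<psi>\<close> or under \<open>\<phi>\<close>, so the tensors \<open>\<psi> v \<otimes> \<phi> v\<close> are orthonormal and Bessel's
  inequality yields \<open>\<theta> r \<le> 1\<close> in the complement (\<open>sum_orthonormal_reps_le_1\<close>).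

  The inequality \<open>p \<bullet> q \<le> \<theta>\<^sub>G p * \<theta> q\<close> is semidefinite duality. It suffices to find,
  for each \<open>t > \<theta>\<^sub>G p\<close>, a unit vector \<open>d\<close> and a representation \<open>\<phi>\<close> for the complement with
  \<open>p v \<le> t * (d \<bullet> \<phi> v)\<^sup>2\<close> for all \<open>v\<close> (\<open>dominating_orthonormal_rep\<close>). Write \<open>w v = sqrt (p v)\<close>.
  A positive semidefinite matrix \<open>B\<close> vanishing on the edges is, up to perturbation and
  normalisation, the Gram matrix of a representation, and Cauchy-Schwarz gives
  \<open>w\<^sup>T B w \<le> \<theta>\<^sub>G p * trace B\<close> (\<open>quad_psd_le_lovasz_number_mult_trace\<close>). Separating a linear
  image of the compact convex set of density matrices from a ray turns this family of inequalities into a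
  single matrix \<open>N\<close> with diagonal \<open>t\<close>, with zeros at distinct non-adjacent vertices, and with \<open>N - w w\<^sup>T\<close>
  positive definite (\<open>lovasz_dual_matrix\<close>). The vectors of which \<open>N\<close> is the Gram matrix, divided
  by \<open>sqrt t\<close>, form \<open>\<phi>\<close>, and \<open>d\<close> is the vector with inner products \<open>w v\<close>, normalised.
\<close>

section \<open>Independent sets and fractional packings\<close>

lemma clique_graph_compl_iff: "clique C (graph_compl E) \<longleftrightarrow> indep C E"
  by (auto simp: clique_def indep_def graph_compl_def)

lemma graph_compl_graph_compl: "E \<subseteq> [UNIV]\<^bsup>2\<^esup> \<Longrightarrow> graph_compl (graph_compl E) = E"
  by (auto simp: graph_compl_def)

lemma indep_number_ge: "indep I E \<Longrightarrow> (\<Sum>v\<in>I. p $ v) \<le> indep_number E p"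
  unfolding indep_number_def by (rule Max_ge) auto

lemma indep_number_attained:
  obtains I where "indep I E" "indep_number E p = (\<Sum>v\<in>I. p $ v)"
proof -
  have "indep_number E p \<in> {\<Sum>v\<in>I. p $ v | I. indep I E}"
    unfolding indep_number_def by (rule Max_in) (auto intro: exI[of _ "{}"])
  with that show thesis by blast
qed

text \<open>
  The constraints of a packing of the complement run over independent sets, so they
  bound their maximum; singletons are independent, which makes \<open>r v \<le> 1\<close> automatic.
\<close>

lemma mem_frac_packings_iff:
  "r \<in> frac_packings (graph_compl E) \<longleftrightarrow> r \<in> weights \<and> indep_number E r \<le> 1"
proof
  assume r: "r \<in> frac_packings (graph_compl E)"
  obtain I where "indep I E" "indep_number E r = (\<Sum>v\<in>I. r $ v)"
    by (rule indep_number_attained)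
  with r show "r \<in> weights \<and> indep_number E r \<le> 1"
    by (auto simp: frac_packings_def weights_def clique_graph_compl_iff)
next
  assume r: "r \<in> weights \<and> indep_number E r \<le> 1"
  have "(\<Sum>v\<in>I. r $ v) \<le> 1" if "indep I E" for I
    using indep_number_ge[OF that, of r] r by simp
  moreover from this[of "{v}" for v] have "r $ v \<le> 1" for v
    by (auto simp: indep_def)
  ultimately show "r \<in> frac_packings (graph_compl E)"
    using r by (auto simp: frac_packings_def weights_def clique_graph_compl_iff)
qed

lemma frac_packing_number_ge: "r \<in> frac_packings E \<Longrightarrow> p \<bullet> r \<le> frac_packing_number E p"
  unfolding inner_vec_def inner_real_def by (metis frac_packing_number_attained)

text \<open>After division by its independence number, \<open>p\<close> competes in the maximum over packings.\<close>

lemma inner_le_indep_mult_frac_packing: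
  assumes p: "p \<in> weights"
  shows "p \<bullet> q \<le> indep_number E p * frac_packing_number (graph_compl E) q"
proof (cases "p = 0")
  case True
  have "indep_number E p = 0" using True by (metis indep_number_attained sum.neutral zero_index)
  then show ?thesis using True by simp
next
  case False
  define a where "a = indep_number E p"
  have a: "0 < a" using indep_number_pos[OF p False] by (simp add: a_def)
  obtain I where I: "indep I E" "indep_number E (p /\<^sub>R a) = (\<Sum>v\<in>I. (p /\<^sub>R a) $ v)"
    by (rule indep_number_attained)
  have "indep_number E (p /\<^sub>R a) = (\<Sum>v\<in>I. p $ v) / a"
    using I(2) by (simp add: sum_distrib_left sum_divide_distrib field_simps)
  also have "\<dots> \<le> 1"
    using indep_number_ge[OF I(1), of p] a by (simp add: a_def)
  finally have "p /\<^sub>R a \<in> frac_packings (graph_compl E)"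
    using p a by (auto simp: mem_frac_packings_iff weights_def)
  from frac_packing_number_ge[OF this, of q] show ?thesis
    using a by (simp add: a_def field_simps inner_commute)
qed

text \<open>
  The common frame of the three identities. The extremal weight \<open>r\<close> is allowed to be zero,
  which forces \<open>m = 0\<close>; then any nonzero weight attains the bound, because all inner
  products are nonnegative.
\<close>

lemma sup_transform_eqI:
  fixes p r :: "real ^ 'v::finite"
  assumes p: "p \<in> weights" and r: "r \<in> weights" "f r \<le> 1" "p \<bullet> r = m"
    and pos: "\<And>q. q \<in> weights \<Longrightarrow> q \<noteq> 0 \<Longrightarrow> 0 < f q"
    and le: "\<And>q. q \<in> weights \<Longrightarrow> q \<noteq> 0 \<Longrightarrow> p \<bullet> q \<le> m * f q"
  shows "ereal m = sup_transform f p"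
proof -
  have nonneg: "0 \<le> p \<bullet> q" if "q \<in> weights" for q
    using p that by (auto simp: inner_vec_def weights_def intro!: sum_nonneg)
  have "\<exists>q\<in>weights - {0}. m \<le> p \<bullet> q / f q"
  proof (cases "r = 0")
    case True
    define q :: "real ^ 'v" where "q = axis undefined 1"
    have "q \<in> weights - {0}" by (auto simp: q_def weights_def axis_def vec_eq_iff)
    moreover from this have "0 \<le> p \<bullet> q / f q" using nonneg pos by (simp add: order_less_imp_le)
    ultimately show ?thesis using True r by auto
  next
    case False
    have "m * f r \<le> m" using nonneg[OF r(1)] r by (simp add: mult_left_le)
    then have "m \<le> p \<bullet> r / f r" using r pos[OF r(1) False] by (simp add: field_simps)
    then show ?thesis using False r by auto
  qed
  then have "ereal m \<le> sup_transform f p"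
    unfolding sup_transform_def by (auto intro: SUP_upper2)
  moreover have "sup_transform f p \<le> ereal m"
    unfolding sup_transform_def using le pos by (intro SUP_least) (auto simp: field_simps)
  ultimately show ?thesis by (rule antisym)
qed

lemma indep_number_eq_transform:
  assumes p: "p \<in> weights"
  shows "ereal (indep_number E p) = sup_transform (frac_packing_number (graph_compl E)) p"
proof -
  obtain I where I: "indep I E" "indep_number E p = (\<Sum>v\<in>I. p $ v)"
    by (rule indep_number_attained)
  define r :: "real ^ 'a" where "r = (\<chi> v. of_bool (v \<in> I))"
  have ip: "q \<bullet> r = (\<Sum>v\<in>I. q $ v)" for q
    by (simp add: inner_vec_def r_def of_bool_def if_distrib sum.If_cases cong: if_cong)
  show ?thesis
  proof (rule sup_transform_eqI[OF p])
    show "r \<in> weights" by (simp add: r_def weights_def)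
    obtain s where s: "s \<in> frac_packings (graph_compl E)"
      "frac_packing_number (graph_compl E) r = (\<Sum>v\<in>UNIV. r $ v * s $ v)"
      by (rule frac_packing_number_attained)
    then have "frac_packing_number (graph_compl E) r = (\<Sum>v\<in>I. s $ v)"
      using ip[of s] by (simp add: inner_vec_def mult.commute)
    also have "\<dots> \<le> 1" using s I by (auto simp: frac_packings_def clique_graph_compl_iff)
    finally show "frac_packing_number (graph_compl E) r \<le> 1" .
    show "p \<bullet> r = indep_number E p" using I ip by simp
  qed (use frac_packing_number_pos inner_le_indep_mult_frac_packing[OF p] in auto)
qed

lemma frac_packing_number_eq_transform:
  assumes p: "p \<in> weights"
  shows "ereal (frac_packing_number (graph_compl E) p) = sup_transform (indep_number E) p"
proof -
  obtain r where r: "r \<in> frac_packings (graph_compl E)"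
    "frac_packing_number (graph_compl E) p = (\<Sum>v\<in>UNIV. p $ v * r $ v)"
    by (rule frac_packing_number_attained)
  show ?thesis
  proof (rule sup_transform_eqI[OF p])
    fix q :: "real ^ 'a" assume "q \<in> weights"
    then show "p \<bullet> q \<le> frac_packing_number (graph_compl E) p * indep_number E q"
      using inner_le_indep_mult_frac_packing[of q p E] by (simp add: inner_commute mult.commute)
  qed (use r indep_number_pos in \<open>auto simp: mem_frac_packings_iff inner_vec_def\<close>)
qed

section \<open>Tensor products of orthonormal representations\<close>

lemma bessel_inequality:
  fixes f :: "'v::finite \<Rightarrow> 'a::real_inner"
  assumes on: "\<And>u v. f u \<bullet> f v = of_bool (u = v)"
  shows "(\<Sum>v\<in>UNIV. (x \<bullet> f v)\<^sup>2) \<le> (norm x)\<^sup>2"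
proof -
  define y where "y = (\<Sum>v\<in>UNIV. (x \<bullet> f v) *\<^sub>R f v)"
  have xy: "x \<bullet> y = (\<Sum>v\<in>UNIV. (x \<bullet> f v)\<^sup>2)"
    by (simp add: y_def inner_sum_right power2_eq_square)
  have "f v \<bullet> y = x \<bullet> f v" for v
    by (simp add: y_def inner_sum_right on of_bool_def if_distrib cong: if_cong)
  then have "y \<bullet> y = x \<bullet> y"
    by (subst (1) y_def) (simp add: inner_sum_left xy power2_eq_square)
  then have "0 \<le> x \<bullet> x - x \<bullet> y"
    using inner_ge_zero[of "x - y"] by (simp add: inner_diff inner_commute)
  then show ?thesis by (simp add: xy power2_norm_eq_inner)
qed

text \<open>
  Matrices serve as the tensor product of \<open>real ^ 'v\<close> with itself, with the entrywise
  inner product; \<open>outer x y\<close> is the pure tensor \<open>x y\<^sup>T\<close>.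
\<close>

definition outer :: "real ^ 'v::finite \<Rightarrow> real ^ 'v \<Rightarrow> real ^ 'v ^ 'v" where
  "outer x y = (\<chi> u v. x $ u * y $ v)"

lemma inner_outer_outer: "outer x y \<bullet> outer x' y' = (x \<bullet> x') * (y \<bullet> y')"
  by (simp add: outer_def inner_vec_def sum_product mult_ac)

lemma norm_outer: "norm (outer x y) = norm x * norm y"
  by (simp add: norm_eq_sqrt_inner inner_outer_outer real_sqrt_mult)

lemma lovasz_number_ge:
  assumes "norm c = 1" "orthonormal_rep (graph_compl E) \<psi>"
  shows "(\<Sum>v\<in>UNIV. p $ v * (c \<bullet> \<psi> v)\<^sup>2) \<le> lovasz_number E p"
  by (rule lovasz_number_attained[of E p]) (use assms in simp)

text \<open>
  Two distinct vertices are non-adjacent in the graph or in its complement, so one factor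
  makes \<open>\<psi> u \<otimes> \<phi> u\<close> and \<open>\<psi> v \<otimes> \<phi> v\<close> orthogonal. Bessel's inequality for these tensors and
  the unit tensor \<open>c \<otimes> d\<close> is the claim.
\<close>

lemma sum_orthonormal_reps_le_1:
  assumes "norm c = 1" "orthonormal_rep (graph_compl E) \<psi>"
    and "norm d = 1" "orthonormal_rep E \<phi>"
  shows "(\<Sum>v\<in>UNIV. (c \<bullet> \<psi> v)\<^sup>2 * (d \<bullet> \<phi> v)\<^sup>2) \<le> 1"
proof -
  have "outer (\<psi> u) (\<phi> u) \<bullet> outer (\<psi> v) (\<phi> v) = of_bool (u = v)" for u v
  proof (cases "u = v")
    case True
    then show ?thesis
      using assms by (simp add: inner_outer_outer orthonormal_rep_def norm_eq_1)
  next
    case False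
    then have "\<psi> u \<bullet> \<psi> v = 0 \<or> \<phi> u \<bullet> \<phi> v = 0"
      using assms by (cases "{u, v} \<in> E") (auto simp: orthonormal_rep_def graph_compl_def orthogonal_def)
    with False show ?thesis by (auto simp: inner_outer_outer)
  qed
  from bessel_inequality[where x = "outer c d" and f = "\<lambda>v. outer (\<psi> v) (\<phi> v)", OF this]
  show ?thesis using assms by (simp add: inner_outer_outer norm_outer power_mult_distrib)
qed

section \<open>Gram vectors of positive definite matrices\<close>

text \<open>
  Cholesky factorisation, by induction on the index set. Eliminating the new index \<open>a\<close> leaves
  the Schur complement, whose quadratic form at \<open>x\<close> is the minimum of the old form over
  the free coordinate \<open>x a\<close> and is therefore positive. That the vectors are supported on
  the index set makes the axis of \<open>a\<close> available as a fresh orthogonal direction.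
\<close>

lemma gram_vectors_on:
  fixes M :: "'v::finite \<Rightarrow> 'v \<Rightarrow> real"
  assumes "finite S"
    and "\<And>u v. M u v = M v u"
    and "\<And>x. \<exists>v\<in>S. x v \<noteq> 0 \<Longrightarrow> 0 < (\<Sum>u\<in>S. \<Sum>v\<in>S. x u * x v * M u v)"
  shows "\<exists>b::'v \<Rightarrow> real ^ 'v. (\<forall>u\<in>S. \<forall>v\<in>S. b u \<bullet> b v = M u v) \<and> (\<forall>u. \<forall>v. v \<notin> S \<longrightarrow> b u $ v = 0)"
  using assms
proof (induction S arbitrary: M rule: finite_induct)
  case empty
  show ?case by (intro exI[of _ "\<lambda>_. 0"]) simp
next
  case (insert a S)
  note sym = insert.prems(1)
  have expand: "(\<Sum>u\<in>insert a S. \<Sum>v\<in>insert a S. x u * x v * M u v) =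
      (x a)\<^sup>2 * M a a + 2 * x a * (\<Sum>v\<in>S. x v * M v a) + (\<Sum>u\<in>S. \<Sum>v\<in>S. x u * x v * M u v)" for x
  proof -
    have "(\<Sum>u\<in>S. x u * x a * M u a) = x a * (\<Sum>v\<in>S. x v * M v a)"
      "(\<Sum>v\<in>S. x a * x v * M a v) = x a * (\<Sum>v\<in>S. x v * M v a)"
      by (simp_all add: sum_distrib_left mult_ac sym[of a])
    then show ?thesis
      using insert.hyps by (simp add: sum.distrib power2_eq_square)
  qed
  have "0 < (\<Sum>u\<in>insert a S. \<Sum>v\<in>insert a S. of_bool (u = a) * of_bool (v = a) * M u v)"
    by (rule insert.prems(2)) auto
  also have "\<dots> = M a a"
    using insert.hyps unfolding expand by (auto intro!: sum.neutral)
  finally have Maa: "0 < M a a" .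
  define M' where "M' u v = M u v - M u a * M v a / M a a" for u v
  have "\<exists>b::'v \<Rightarrow> real ^ 'v. (\<forall>u\<in>S. \<forall>v\<in>S. b u \<bullet> b v = M' u v) \<and> (\<forall>u. \<forall>v. v \<notin> S \<longrightarrow> b u $ v = 0)"
  proof (rule insert.IH)
    show "M' u v = M' v u" for u v by (simp add: M'_def sym[of u v] mult.commute)
  next
    fix x :: "'v \<Rightarrow> real" assume x: "\<exists>v\<in>S. x v \<noteq> 0"
    define s where "s = (\<Sum>v\<in>S. x v * M v a)"
    (* x, with its coordinate at a changed to the value that minimises the form of M *)
    define z where "z = x(a := - s / M a a)"
    have zS: "z v = x v" if "v \<in> S" for v using that insert.hyps by (auto simp: z_def)
    have "0 < (\<Sum>u\<in>insert a S. \<Sum>v\<in>insert a S. z u * z v * M u v)"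
      using x zS by (intro insert.prems(2)) auto
    also have "\<dots> = (z a)\<^sup>2 * M a a + 2 * z a * s + (\<Sum>u\<in>S. \<Sum>v\<in>S. x u * x v * M u v)"
      unfolding expand using zS by (simp add: s_def)
    also have "(z a)\<^sup>2 * M a a + 2 * z a * s = - s * s / M a a"
      using Maa by (simp add: z_def power2_eq_square field_simps)
    also have "- s * s / M a a + (\<Sum>u\<in>S. \<Sum>v\<in>S. x u * x v * M u v) =
        (\<Sum>u\<in>S. \<Sum>v\<in>S. x u * x v * M' u v)"
      by (simp add: M'_def s_def sum_product right_diff_distrib sum_subtractf sum_divide_distrib mult_ac)
    finally show "0 < (\<Sum>u\<in>S. \<Sum>v\<in>S. x u * x v * M' u v)" .
  qed
  then obtain b :: "'v \<Rightarrow> real ^ 'v" where b: "\<And>u v. u \<in> S \<Longrightarrow> v \<in> S \<Longrightarrow> b u \<bullet> b v = M' u v"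
    "\<And>u v. v \<notin> S \<Longrightarrow> b u $ v = 0" by blast
  define b' where "b' v = (if v = a then 0 else b v) + (M v a / sqrt (M a a)) *\<^sub>R axis a 1" for v
  have ba: "b v \<bullet> axis a 1 = 0" "axis a 1 \<bullet> b v = 0" for v
    using b(2)[of a] insert.hyps by (simp_all add: inner_axis inner_axis')
  have b'_a: "b' a = sqrt (M a a) *\<^sub>R axis a 1"
    using Maa by (simp add: b'_def real_div_sqrt)
  have b'_S: "b' v = b v + (M v a / sqrt (M a a)) *\<^sub>R axis a 1" if "v \<in> S" for v
    using that insert.hyps by (auto simp: b'_def)
  have b'_aS: "b' v \<bullet> b' a = M v a" if "v \<in> S" for v
    using that Maa by (simp add: b'_a b'_S inner_add_left ba inner_axis_axis)
  have b'_SS: "b' u \<bullet> b' v = M u v" if "u \<in> S" "v \<in> S" for u v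
    using that Maa by (simp add: b'_S inner_add_left inner_add_right ba inner_axis_axis b(1) M'_def)
  have b'_aa: "b' a \<bullet> b' a = M a a"
    using Maa by (simp add: b'_a inner_axis_axis)
  have "b' u \<bullet> b' v = M u v" if "u \<in> insert a S" "v \<in> insert a S" for u v
    using that b'_aa b'_SS b'_aS sym inner_commute by (metis insert_iff)
  moreover have "b' u $ v = 0" if "v \<notin> insert a S" for u v
    using that b(2) by (auto simp: b'_def axis_def)
  ultimately show ?case by blast
qed

definition quad :: "real ^ 'v::finite ^ 'v \<Rightarrow> real ^ 'v \<Rightarrow> real" where
  "quad M x = M \<bullet> outer x x"

lemma quad_eq_sum: "quad M x = (\<Sum>u\<in>UNIV. \<Sum>v\<in>UNIV. x $ u * x $ v * M $ u $ v)"
  by (simp add: quad_def outer_def inner_vec_def mult_ac)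

lemma gram_vectors:
  fixes M :: "real ^ 'v::finite ^ 'v"
  assumes sym: "\<And>u v. M $ u $ v = M $ v $ u"
    and pd: "\<And>x. x \<noteq> 0 \<Longrightarrow> 0 < quad M x"
  obtains b :: "'v \<Rightarrow> real ^ 'v" where "\<And>u v. b u \<bullet> b v = M $ u $ v"
proof -
  have "\<exists>b::'v \<Rightarrow> real ^ 'v. (\<forall>u\<in>UNIV. \<forall>v\<in>UNIV. b u \<bullet> b v = M $ u $ v) \<and> (\<forall>u. \<forall>v. v \<notin> UNIV \<longrightarrow> b u $ v = 0)"
  proof (rule gram_vectors_on)
    fix x :: "'v \<Rightarrow> real" assume "\<exists>v\<in>UNIV. x v \<noteq> 0"
    then have "(\<chi> v. x v) \<noteq> 0" by (auto simp: vec_eq_iff)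
    from pd[OF this] show "0 < (\<Sum>u\<in>UNIV. \<Sum>v\<in>UNIV. x u * x v * M $ u $ v)"
      by (simp add: quad_eq_sum)
  qed (use sym in auto)
  with that show thesis by auto
qed

section \<open>The semidefinite bound\<close>

lemma lovasz_number_nonneg:
  assumes "p \<in> weights"
  shows "0 \<le> lovasz_number E p"
proof -
  have "0 \<le> (\<Sum>v\<in>UNIV. p $ v * (axis undefined 1 \<bullet> axis v (1::real))\<^sup>2)"
    using assms by (auto simp: weights_def intro!: sum_nonneg)
  also have "\<dots> \<le> lovasz_number E p"
    by (intro lovasz_number_ge orthonormal_rep_axis norm_axis_1)
  finally show ?thesis .
qed

lemma inner_mat_1: "M \<bullet> mat 1 = trace M"
  by (simp add: inner_vec_def mat_def trace_def if_distrib cong: if_cong)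

lemma trace_outer: "trace (outer x x) = x \<bullet> x"
  by (simp add: trace_def outer_def inner_vec_def)

lemma quad_mat_1: "quad (mat 1) x = x \<bullet> x"
  by (simp add: quad_def inner_commute[of "mat 1"] inner_mat_1 trace_outer)

lemma quad_eq_inner_matrix_vector: "quad M x = x \<bullet> (M *v x)"
  by (simp add: quad_eq_sum inner_vec_def matrix_vector_mult_def sum_distrib_left mult_ac)

lemma quad_axis: "quad M (axis v 1) = M $ v $ v"
  by (simp add: quad_eq_inner_matrix_vector inner_axis' matrix_vector_mult_basis column_def)

lemma quad_scaleR: "quad M (r *\<^sub>R x) = r\<^sup>2 * quad M x"
  by (simp add: quad_eq_inner_matrix_vector matrix_vector_mult_scaleR power2_eq_square)

text \<open>
  The Gram vectors \<open>b v\<close> of \<open>B\<close> are orthogonal along edges, so normalising them gives a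
  representation that competes in \<open>\<theta> p\<close>, with \<open>c\<close> pointing along \<open>s = (\<Sum>v. w v * b v)\<close>. As
  \<open>w\<^sup>T B w = (norm s)\<^sup>2\<close>, the Cauchy-Schwarz inequality separates the lengths of the \<open>b v\<close>, whose
  squares add up to the trace, from the objective of \<open>\<theta>\<close>. Definiteness ensures that no
  \<open>b v\<close> is zero.
\<close>

lemma quad_pd_le_lovasz_number_mult_trace:
  fixes B :: "real ^ 'v::finite ^ 'v"
  assumes p: "p \<in> weights"
    and sym: "\<And>u v. B $ u $ v = B $ v $ u"
    and pd: "\<And>x. x \<noteq> 0 \<Longrightarrow> 0 < quad B x"
    and zero: "\<And>u v. u \<noteq> v \<Longrightarrow> {u, v} \<in> E \<Longrightarrow> B $ u $ v = 0"
  shows "quad B (\<chi> v. sqrt (p $ v)) \<le> lovasz_number E p * trace B"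
proof -
  obtain b :: "'v \<Rightarrow> real ^ 'v" where b: "\<And>u v. b u \<bullet> b v = B $ u $ v"
    using gram_vectors[OF sym pd] by blast
  have b0: "b v \<noteq> 0" for v
    using pd[of "axis v 1"] b[of v v] by (auto simp: quad_axis axis_eq_0_iff)
  define s where "s = (\<Sum>v\<in>UNIV. sqrt (p $ v) *\<^sub>R b v)"
  have s: "quad B (\<chi> v. sqrt (p $ v)) = (norm s)\<^sup>2"
    unfolding s_def power2_norm_eq_inner inner_sum_left inner_sum_right quad_eq_sum
    using sym by (simp add: b mult_ac)
  have tr: "trace B = (\<Sum>v\<in>UNIV. (norm (b v))\<^sup>2)"
    by (simp add: trace_def power2_norm_eq_inner b)
  show ?thesis
  proof (cases "s = 0")
    case True
    then show ?thesis
      using s tr lovasz_number_nonneg[OF p, of E] by (simp add: sum_nonneg)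
  next
    case False
    define c where "c = s /\<^sub>R norm s"
    define \<psi> where "\<psi> v = b v /\<^sub>R norm (b v)" for v
    have "norm c = 1" using False by (simp add: c_def)
    moreover have "orthonormal_rep (graph_compl E) \<psi>"
      using b0 zero by (auto simp: orthonormal_rep_def graph_compl_def \<psi>_def orthogonal_def b)
    ultimately have le: "(\<Sum>v\<in>UNIV. p $ v * (c \<bullet> \<psi> v)\<^sup>2) \<le> lovasz_number E p"
      by (rule lovasz_number_ge)
    have "norm s = c \<bullet> s"
      using False by (simp add: c_def power2_norm_eq_inner[symmetric] power2_eq_square)
    also have "\<dots> = (\<Sum>v\<in>UNIV. (sqrt (p $ v) * (c \<bullet> \<psi> v)) * norm (b v))"
      unfolding s_def inner_sum_right using b0 by (intro sum.cong) (simp_all add: \<psi>_def)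
    finally have "(norm s)\<^sup>2 = (\<Sum>v\<in>UNIV. (sqrt (p $ v) * (c \<bullet> \<psi> v)) * norm (b v))\<^sup>2"
      by simp
    also have "\<dots> \<le> (\<Sum>v\<in>UNIV. (sqrt (p $ v) * (c \<bullet> \<psi> v))\<^sup>2) * (\<Sum>v\<in>UNIV. (norm (b v))\<^sup>2)"
      by (rule Cauchy_Schwarz_ineq_sum)
    also have "(\<Sum>v\<in>UNIV. (sqrt (p $ v) * (c \<bullet> \<psi> v))\<^sup>2) = (\<Sum>v\<in>UNIV. p $ v * (c \<bullet> \<psi> v)\<^sup>2)"
      using p by (simp add: power_mult_distrib weights_def)
    also have "\<dots> * (\<Sum>v\<in>UNIV. (norm (b v))\<^sup>2) \<le> lovasz_number E p * trace B"
      unfolding tr by (intro mult_right_mono le sum_nonneg) auto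
    finally show ?thesis using s by simp
  qed
qed

text \<open>The semidefinite case is the limit of the definite one for \<open>B + e I\<close> as \<open>e\<close> tends to 0.\<close>

lemma quad_psd_le_lovasz_number_mult_trace:
  fixes B :: "real ^ 'v::finite ^ 'v"
  assumes p: "p \<in> weights"
    and sym: "\<And>u v. B $ u $ v = B $ v $ u"
    and psd: "\<And>x. 0 \<le> quad B x"
    and zero: "\<And>u v. u \<noteq> v \<Longrightarrow> {u, v} \<in> E \<Longrightarrow> B $ u $ v = 0"
  shows "quad B (\<chi> v. sqrt (p $ v)) \<le> lovasz_number E p * trace B"
proof (rule field_le_epsilon)
  fix \<epsilon> :: real assume \<epsilon>: "0 < \<epsilon>"
  define w where "w = (\<chi> v. sqrt (p $ v))"
  define k where "k = lovasz_number E p * real CARD('v)"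
  have k: "0 \<le> k" using lovasz_number_nonneg[OF p] by (simp add: k_def)
  define e where "e = \<epsilon> / (k + 1)"
  have e: "0 < e" "k * e \<le> \<epsilon>" using \<epsilon> k by (simp_all add: e_def field_simps)
  have quad: "quad (B + e *\<^sub>R mat 1) x = quad B x + e * (x \<bullet> x)" for x
    using quad_mat_1[of x] by (simp add: quad_def inner_add_left)
  have tr: "trace (B + e *\<^sub>R mat 1) = trace B + e * real CARD('v)"
    by (simp add: trace_def mat_def sum.distrib)
  have "quad B w \<le> quad (B + e *\<^sub>R mat 1) w"
    using e by (simp add: quad)
  also have "\<dots> \<le> lovasz_number E p * trace (B + e *\<^sub>R mat 1)"
    unfolding w_def
  proof (rule quad_pd_le_lovasz_number_mult_trace[OF p])
    show "0 < quad (B + e *\<^sub>R mat 1) x" if "x \<noteq> 0" for x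
      using that e psd[of x] by (simp add: quad add_nonneg_pos)
  qed (auto simp: mat_def sym zero)
  also have "\<dots> = lovasz_number E p * trace B + k * e"
    by (simp add: tr k_def algebra_simps)
  finally show "quad B (\<chi> v. sqrt (p $ v)) \<le> lovasz_number E p * trace B + \<epsilon>"
    using e by (simp add: w_def)
qed

section \<open>Semidefinite duality\<close>

text \<open>
  For a density matrix \<open>B\<close> (symmetric, positive semidefinite, trace 1) that vanishes on the
  edges, the previous bound and \<open>\<theta> p < t\<close> say \<open>\<langle>w w\<^sup>T - t I, B\<rangle> < 0\<close>. Hence the linear map
  sending \<open>B\<close> to its edge entries and to \<open>\<langle>w w\<^sup>T - t I, B\<rangle>\<close> takes the density matrices to a compact
  convex set that misses the ray \<open>{0} \<times> {0..}\<close>. The separating functional \<open>(A, \<sigma>)\<close>,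
  divided by \<open>\<sigma>\<close>, symmetrised and restricted to the edges, is the correction of \<open>t I\<close>
  that yields \<open>N\<close>; evaluated at the rank one matrices \<open>x x\<^sup>T\<close>, separation reads
  \<open>x\<^sup>T N x > (w \<bullet> x)\<^sup>2\<close>.
\<close>

lemma lovasz_dual_matrix:
  fixes E :: "'v::finite set set"
  assumes E: "E \<subseteq> [UNIV]\<^bsup>2\<^esup>" and p: "p \<in> weights" and t: "lovasz_number E p < t"
  obtains N :: "real ^ 'v ^ 'v" where "\<And>u v. N $ u $ v = N $ v $ u" "\<And>v. N $ v $ v = t"
    "\<And>u v. u \<noteq> v \<Longrightarrow> {u, v} \<notin> E \<Longrightarrow> N $ u $ v = 0"
    "\<And>x. x \<noteq> 0 \<Longrightarrow> ((\<chi> v. sqrt (p $ v)) \<bullet> x)\<^sup>2 < quad N x"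
proof -
  have loopless: "{v} \<notin> E" for v using E by (auto simp: nsets_def)
  define w where "w = (\<chi> v. sqrt (p $ v))"
  define W :: "real ^ 'v ^ 'v" where "W = outer w w - t *\<^sub>R mat 1"
  define mask :: "real ^ 'v ^ 'v \<Rightarrow> real ^ 'v ^ 'v" where
    "mask B = (\<chi> u v. if {u, v} \<in> E then B $ u $ v else 0)" for B
  define L where "L B = (mask B, W \<bullet> B)" for B
  (* Generating the density matrices from those of rank one makes compactness immediate;
     P collects their defining properties. *)
  define F where "F = convex hull (\<lambda>x::real ^ 'v. outer x x) ` sphere 0 1"
  define P where "P = {B::real ^ 'v ^ 'v. (\<forall>u v. B $ u $ v = B $ v $ u) \<and> (\<forall>x. 0 \<le> quad B x) \<and> trace B = 1}"
  have linL: "linear L"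
    by (rule linearI) (auto simp: L_def mask_def vec_eq_iff inner_add_right)
  have "convex P"
  proof (rule convexI)
    fix A B :: "real ^ 'v ^ 'v" and r s :: real
    assume "A \<in> P" "B \<in> P" "0 \<le> r" "0 \<le> s" "r + s = 1"
    moreover have "trace (r *\<^sub>R A + s *\<^sub>R B) = r * trace A + s * trace B"
      by (simp add: trace_def sum.distrib sum_distrib_left)
    ultimately show "r *\<^sub>R A + s *\<^sub>R B \<in> P"
      by (simp add: P_def quad_def inner_add_left)
  qed
  moreover have "outer x x \<in> P" if "norm x = 1" for x
  proof -
    have "0 \<le> quad (outer x x) y" for y by (simp add: quad_def inner_outer_outer)
    then show ?thesis
      using that by (simp add: P_def trace_outer flip: power2_norm_eq_inner) (simp add: outer_def mult.commute)
  qed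
  ultimately have FP: "F \<subseteq> P"
    unfolding F_def by (intro hull_minimal) auto
  have "continuous_on (sphere 0 1) (\<lambda>x::real ^ 'v. outer x x)"
    unfolding outer_def by (intro continuous_intros)
  then have "compact F"
    unfolding F_def by (intro compact_convex_hull compact_continuous_image compact_sphere)
  then have "compact (L ` F)"
    using linL by (intro compact_continuous_image linear_continuous_on) (simp add: linear_conv_bounded_linear)
  moreover have "convex (L ` F)"
    using linL by (intro convex_linear_image) (simp_all add: F_def)
  moreover have axF: "outer (axis v 1) (axis v 1) \<in> F" for v
    unfolding F_def by (intro hull_inc imageI) simp
  then have "L ` F \<noteq> {}" by blast
  moreover have "L ` F \<inter> {0} \<times> {0..} = {}"
  proof -
    have "W \<bullet> B < 0" if "B \<in> F" "mask B = 0" for B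
    proof -
      have B: "B \<in> P" using that FP by blast
      have "B $ u $ v = 0" if "{u, v} \<in> E" for u v
        using \<open>mask B = 0\<close> that by (auto simp: mask_def vec_eq_iff split: if_splits)
      then have "quad B w \<le> lovasz_number E p * trace B"
        using B unfolding w_def P_def by (intro quad_psd_le_lovasz_number_mult_trace p) auto
      moreover have "W \<bullet> B = quad B w - t * trace B"
        by (simp add: W_def quad_def inner_commute[of _ B] inner_diff_right inner_mat_1)
      ultimately show ?thesis using B t by (simp add: P_def)
    qed
    then show ?thesis by (force simp: L_def)
  qed
  moreover have "convex ({0::real^'v^'v} \<times> {0::real..})" "closed ({0::real^'v^'v} \<times> {0::real..})"
    by (auto intro!: convex_Times closed_Times)
  ultimately obtain a \<beta> where a: "\<forall>x\<in>L ` F. a \<bullet> x < \<beta>" "\<forall>x\<in>{0} \<times> {0..}. \<beta> < a \<bullet> x"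
    using separating_hyperplane_compact_closed[of "L ` F" "{0} \<times> {0..}"] by blast
  obtain A \<sigma> where A\<sigma>: "a = (A, \<sigma>)" by (cases a)
  have ray: "\<beta> < \<sigma> * s" if "0 \<le> s" for s
    using a(2) that by (auto simp: A\<sigma> inner_prod_def)
  have \<beta>: "\<beta> < 0" using ray[of 0] by simp
  (* otherwise the functional would tend to -\<infinity> along the ray *)
  have \<sigma>0: "0 \<le> \<sigma>"
  proof (rule ccontr)
    assume "\<not> 0 \<le> \<sigma>"
    then show False using ray[of "\<beta> / \<sigma>"] \<beta> by (simp add: divide_nonpos_nonpos)
  qed
  have mask_adj: "A \<bullet> mask B = mask A \<bullet> B" for B
    by (auto simp: mask_def inner_vec_def intro!: sum.cong)
  have sep: "quad (mask A) x + \<sigma> * ((w \<bullet> x)\<^sup>2 - t) < 0" if "norm x = 1" for x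
  proof -
    have "outer x x \<in> F" using that unfolding F_def by (intro hull_inc imageI) simp
    then have "a \<bullet> L (outer x x) < \<beta>" using a(1) by blast
    moreover have "W \<bullet> outer x x = (w \<bullet> x)\<^sup>2 - t"
      using that quad_mat_1[of x]
      by (simp add: W_def quad_def inner_diff_left inner_outer_outer power2_eq_square norm_eq_1)
    ultimately show ?thesis
      using \<beta> by (simp add: A\<sigma> L_def inner_prod_def mask_adj quad_def)
  qed
  (* at a unit coordinate vector the edge part contributes nothing, so \<sigma> cannot vanish *)
  have "\<sigma> \<noteq> 0"
  proof
    assume "\<sigma> = 0"
    with sep[of "axis undefined 1"] show False by (simp add: quad_axis mask_def loopless)
  qed
  with \<sigma>0 have \<sigma>: "0 < \<sigma>" by simp
  define N where "N = t *\<^sub>R mat 1 - (1 / (2 * \<sigma>)) *\<^sub>R (mask A + transpose (mask A))"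
  have quad_transpose: "quad (transpose M) x = quad M x" for M :: "real ^ 'v ^ 'v" and x
    by (metis quad_eq_inner_matrix_vector dot_lmul_matrix inner_commute transpose_matrix_vector)
  have quadN: "quad N x = t * (x \<bullet> x) - quad (mask A) x / \<sigma>" for x
    using quad_mat_1[of x] quad_transpose[of "mask A" x] \<sigma>
    by (simp add: N_def quad_def inner_diff_left inner_add_left field_simps)
  show thesis
  proof (rule that)
    show "N $ u $ v = N $ v $ u" for u v
      by (simp add: N_def transpose_def mat_def)
    show "N $ v $ v = t" for v
      by (simp add: N_def transpose_def mat_def mask_def loopless)
    show "N $ u $ v = 0" if "u \<noteq> v" "{u, v} \<notin> E" for u v
      using that by (simp add: N_def transpose_def mat_def mask_def insert_commute)
    fix x :: "real ^ 'v" assume x: "x \<noteq> 0"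
    define y where "y = x /\<^sub>R norm x"
    have y: "norm y = 1" using x by (simp add: y_def)
    have "(w \<bullet> y)\<^sup>2 < quad N y"
      using sep[OF y] y \<sigma> by (simp add: quadN norm_eq_1 field_simps)
    then have "(norm x)\<^sup>2 * (w \<bullet> y)\<^sup>2 < (norm x)\<^sup>2 * quad N y"
      using x by simp
    also have "\<dots> = quad N x" using x by (simp add: y_def quad_scaleR power_inverse)
    also have "(norm x)\<^sup>2 * (w \<bullet> y)\<^sup>2 = (w \<bullet> x)\<^sup>2"
      using x by (simp add: y_def power_mult_distrib power_inverse)
    finally show "((\<chi> v. sqrt (p $ v)) \<bullet> x)\<^sup>2 < quad N x" by (simp add: w_def)
  qed
qed

text \<open>
  The Gram vectors \<open>y v\<close> of \<open>N\<close> have length \<open>sqrt t\<close> and are orthogonal at non-adjacent pairs.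
  With \<open>N a = w\<close>, the combination \<open>d = (\<Sum>v. a v * y v)\<close> satisfies \<open>d \<bullet> y v = w v\<close> and
  \<open>d \<bullet> d = w \<bullet> a = a\<^sup>T N a\<close>, which is at least \<open>(w \<bullet> a)\<^sup>2\<close>. So \<open>d\<close> has norm at most 1, and
  normalising it can only enlarge the inner products.
\<close>

lemma dominating_orthonormal_rep:
  fixes E :: "'v::finite set set"
  assumes E: "E \<subseteq> [UNIV]\<^bsup>2\<^esup>" and p: "p \<in> weights" and t: "lovasz_number E p < t"
  obtains d \<phi> where "norm d = 1" "orthonormal_rep E \<phi>" "\<And>v. p $ v \<le> t * (d \<bullet> \<phi> v)\<^sup>2"
proof -
  define w where "w = (\<chi> v. sqrt (p $ v))"
  have t0: "0 < t" using lovasz_number_nonneg[OF p, of E] t by simp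
  obtain N :: "real ^ 'v ^ 'v" where sym: "\<And>u v. N $ u $ v = N $ v $ u" and diag: "\<And>v. N $ v $ v = t"
    and zero: "\<And>u v. u \<noteq> v \<Longrightarrow> {u, v} \<notin> E \<Longrightarrow> N $ u $ v = 0"
    and gt: "\<And>x. x \<noteq> 0 \<Longrightarrow> (w \<bullet> x)\<^sup>2 < quad N x"
    using lovasz_dual_matrix[OF E p t] unfolding w_def by blast
  have pd: "0 < quad N x" if "x \<noteq> 0" for x
    using gt[OF that] by (meson le_less_trans zero_le_power2)
  obtain y :: "'v \<Rightarrow> real ^ 'v" where y: "\<And>u v. y u \<bullet> y v = N $ u $ v"
    using gram_vectors[OF sym pd] by blast
  have "inj ((*v) N)"
    using pd by (subst linear_injective_0) (force simp: quad_eq_inner_matrix_vector)+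
  then have "surj ((*v) N)" by (intro linear_inj_imp_surj) auto
  then obtain a where a: "N *v a = w" by (metis surjD)
  define d where "d = (\<Sum>v\<in>UNIV. a $ v *\<^sub>R y v)"
  have dy: "d \<bullet> y v = w $ v" for v
    using a[symmetric] by (simp add: d_def inner_sum_left y matrix_vector_mult_def sym mult.commute)
  have dd: "d \<bullet> d = w \<bullet> a"
  proof -
    have "d \<bullet> d = (\<Sum>v\<in>UNIV. a $ v * w $ v)"
      by (subst (2) d_def) (simp add: inner_sum_right dy)
    then show ?thesis by (simp add: inner_vec_def[of w] mult.commute)
  qed
  have "(w \<bullet> a)\<^sup>2 \<le> w \<bullet> a"
    using gt[of a] a by (cases "a = 0") (auto simp: quad_eq_inner_matrix_vector inner_commute)
  then have "(d \<bullet> d) * (d \<bullet> d) \<le> d \<bullet> d" by (simp add: dd power2_eq_square)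
  then have d1: "d \<bullet> d \<le> 1" by (cases "d = 0") (auto simp: mult_le_cancel_right1)
  have ny: "norm (y v) = sqrt t" for v by (simp add: norm_eq_sqrt_inner y diag)
  define \<phi> where "\<phi> v = y v /\<^sub>R sqrt t" for v
  have \<phi>: "orthonormal_rep E \<phi>"
    using t0 zero by (simp add: orthonormal_rep_def \<phi>_def ny orthogonal_def y)
  (* d = 0 only if p = 0, and then any unit vector will do *)
  define e :: "real ^ 'v" where "e = (if d = 0 then axis undefined 1 else d /\<^sub>R norm d)"
  have "norm e = 1" by (simp add: e_def)
  moreover have "p $ v \<le> t * (e \<bullet> \<phi> v)\<^sup>2" for v
  proof -
    have pv: "p $ v = (d \<bullet> y v)\<^sup>2" using p by (simp add: dy w_def weights_def)
    show ?thesis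
    proof (cases "d = 0")
      case True
      then show ?thesis using pv t0 by simp
    next
      case False
      have "t * (e \<bullet> \<phi> v)\<^sup>2 = (d \<bullet> y v)\<^sup>2 / (d \<bullet> d)"
        using False t0 by (simp add: e_def \<phi>_def power_mult_distrib power_divide divide_simps power2_norm_eq_inner)
      also have "(d \<bullet> y v)\<^sup>2 \<le> \<dots>"
        using False d1 by (simp add: le_divide_eq mult_left_le)
      finally show ?thesis using pv by simp
    qed
  qed
  ultimately show thesis using \<phi> that by blast
qed

text \<open>
  A pair \<open>d\<close>, \<open>\<phi>\<close> dominating \<open>p\<close> with constant \<open>t\<close> is also a competitor for \<open>\<theta> q\<close> in the
  complement; then \<open>t\<close> decreases to \<open>\<theta> p\<close>.
\<close>

lemma inner_le_lovasz_mult_lovasz: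
  assumes E: "E \<subseteq> [UNIV]\<^bsup>2\<^esup>" and p: "p \<in> weights" and q: "q \<in> weights" "q \<noteq> 0"
  shows "p \<bullet> q \<le> lovasz_number E p * lovasz_number (graph_compl E) q"
proof -
  define m where "m = lovasz_number (graph_compl E) q"
  have m: "0 < m" using lovasz_number_pos[OF q] by (simp add: m_def)
  have "p \<bullet> q / m \<le> lovasz_number E p"
  proof (rule dense_ge)
    fix t assume t: "lovasz_number E p < t"
    have t0: "0 < t" using lovasz_number_nonneg[OF p, of E] t by simp
    obtain d \<phi> where d: "norm d = 1" "orthonormal_rep E \<phi>" "\<And>v. p $ v \<le> t * (d \<bullet> \<phi> v)\<^sup>2"
      using dominating_orthonormal_rep[OF E p t] by blast
    have "p \<bullet> q = (\<Sum>v\<in>UNIV. p $ v * q $ v)" by (simp add: inner_vec_def)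
    also have "\<dots> \<le> (\<Sum>v\<in>UNIV. t * (d \<bullet> \<phi> v)\<^sup>2 * q $ v)"
      using q d(3) by (intro sum_mono mult_right_mono) (auto simp: weights_def)
    also have "\<dots> = t * (\<Sum>v\<in>UNIV. q $ v * (d \<bullet> \<phi> v)\<^sup>2)"
      by (simp add: sum_distrib_left mult_ac)
    also have "\<dots> \<le> t * m"
      unfolding m_def using d t0
      by (intro mult_left_mono lovasz_number_ge) (auto simp: graph_compl_graph_compl[OF E])
    finally show "p \<bullet> q / m \<le> t" using m by (simp add: field_simps)
  qed
  then show ?thesis using m by (simp add: m_def field_simps)
qed

lemma lovasz_number_eq_transform:
  fixes E :: "'v::finite set set"
  assumes E: "E \<subseteq> [UNIV]\<^bsup>2\<^esup>" and p: "p \<in> weights"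
  shows "ereal (lovasz_number E p) = sup_transform (lovasz_number (graph_compl E)) p"
proof -
  obtain c \<psi> where c: "norm c = 1" "orthonormal_rep (graph_compl E) \<psi>"
    "lovasz_number E p = (\<Sum>v\<in>UNIV. p $ v * \<bar>c \<bullet> \<psi> v\<bar>\<^sup>2)"
    by (rule lovasz_number_attained)
  define r where "r = (\<chi> v. (c \<bullet> \<psi> v)\<^sup>2)"
  show ?thesis
  proof (rule sup_transform_eqI[OF p])
    show "r \<in> weights" by (simp add: r_def weights_def)
    show "p \<bullet> r = lovasz_number E p" by (simp add: r_def c inner_vec_def)
    obtain d \<phi> where d: "norm d = 1" "orthonormal_rep (graph_compl (graph_compl E)) \<phi>"
      "lovasz_number (graph_compl E) r = (\<Sum>v\<in>UNIV. r $ v * \<bar>d \<bullet> \<phi> v\<bar>\<^sup>2)"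
      by (rule lovasz_number_attained)
    then show "lovasz_number (graph_compl E) r \<le> 1"
      using sum_orthonormal_reps_le_1[OF c(1,2) d(1)] by (simp add: r_def graph_compl_graph_compl[OF E])
  qed (use lovasz_number_pos inner_le_lovasz_mult_lovasz[OF E p] in auto)
qed

section \<open>The three identities\<close>

theorem theorem4:
  fixes E :: "'v::finite set set"
  assumes "E \<subseteq> [UNIV]\<^bsup>2\<^esup>"
  shows "(\<forall>p\<in>weights. ereal (indep_number E p) = sup_transform (frac_packing_number (graph_compl E)) p) \<and>
         (\<forall>p\<in>weights. ereal (frac_packing_number E p) = sup_transform (indep_number (graph_compl E)) p) \<and>
         (\<forall>p\<in>weights. ereal (lovasz_number E p) = sup_transform (lovasz_number (graph_compl E)) p)"
  using indep_number_eq_transform frac_packing_number_eq_transform[of _ "graph_compl E"]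
    lovasz_number_eq_transform[OF assms] graph_compl_graph_compl[OF assms]
  by auto

end
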